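(* For every integer $n \ge 7$ with $n \equiv 0,2 \pmod{7}$, there is a unique binary LCD $[n,3,\lfloor 4n/7 \rfloor - 1]$ code, up to equivalence.
   Context: All codes are binary linear codes; an $[n,k,d]$ code is a $k$-dimensional subspace of $\mathbb{F}_2^n$ with minimum nonzero Hamming weight $d$. A code $C$ is LCD if $C \cap C^\perp = \{\mathbf{0}_n\}$, where $C^\perp$ is the dual with respect to the standard inner product. Two binary codes are equivalent if one is obtained from the other by a permutation of coordinates. *)

theory Defs
  imports "HOL-Analysis.Analysis" "HOL-Library.Z2"
begin

definition hamming_weight :: "bit ^ 'n \<Rightarrow> nat" where
  "hamming_weight x = card {i. x $ i \<noteq> 0}"

definition min_weight :: "(bit ^ 'n) set \<Rightarrow> nat" where
  "min_weight C = Min (hamming_weight ` (C - {0}))"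

text \<open>The length of a code \<open>C :: (bit ^ 'n) set\<close> is \<open>CARD('n)\<close>. Codes with
  \<open>k = 0\<close> have no nonzero codeword, so \<open>min_weight\<close> is meaningful only for \<open>k > 0\<close>.\<close>

definition is_code :: "(bit ^ 'n) set \<Rightarrow> nat \<Rightarrow> nat \<Rightarrow> nat \<Rightarrow> bool" where
  "is_code C n k d \<longleftrightarrow>
     CARD('n) = n \<and> vec.subspace C \<and> vec.dim C = k \<and> min_weight C = d"

definition dual_code :: "(bit ^ 'n) set \<Rightarrow> (bit ^ 'n) set" where
  "dual_code C = {x. \<forall>c\<in>C. scalar_product x c = 0}"

definition is_LCD :: "(bit ^ 'n) set \<Rightarrow> bool" where
  "is_LCD C \<longleftrightarrow> C \<inter> dual_code C = {0}"

definition code_equiv :: "(bit ^ 'n) set \<Rightarrow> (bit ^ 'n) set \<Rightarrow> bool" where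
  "code_equiv C D \<longleftrightarrow>
     (\<exists>p :: 'n \<Rightarrow> 'n. bij p \<and> D = (\<lambda>x. \<chi> i. x $ p i) ` C)"

end

theory Submission
  imports Defs
begin

text \<open>
  Write \<open>n = 7q + 2t\<close> with \<open>t \<le> 1\<close>, so that the minimum weight is \<open>4q + t - 1\<close>. Each nonzero column
  of a generator matrix contributes to exactly four of the seven nonzero codewords, so the weights
  add up to \<open>4(n - m)\<close>, where \<open>m\<close> counts the zero columns. Being LCD means that the Gram matrix is
  nonsingular; over the two-element field it is then not alternating, so the words of even weight
  form a plane, on which the form is nondegenerate. Hence the three even weights sum to 2 modulo 4,
  and together with the lower bound on all weights this leaves a single possibility: \<open>m = 0\<close>, one
  even word \<open>x\<close> and one odd word \<open>z\<close> exceed the least weight of their parity by 2, and all other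
  words attain it. The weights determine the multiplicities of the columns, and these determine the
  code up to a permutation of coordinates.
\<close>

section \<open>Vectors and spans over the two-element field\<close>

lemma bit_vec_add_self [simp]:
  fixes x y :: "bit ^ 'n"
  shows "x + x = 0" and "x + (x + y) = y"
  by (simp_all add: vec_eq_iff flip: add.assoc)

lemma bit_vec_minus [simp]:
  fixes x y :: "bit ^ 'n"
  shows "x - y = x + y"
  by (simp add: vec_eq_iff)

lemma bit_vec_add_eq_iff:
  fixes x y z :: "bit ^ 'n"
  shows "x + y = z \<longleftrightarrow> x = y + z"
  by (metis add.commute bit_vec_add_self(2))

text \<open>The only scalars are 0 and 1, so a new generator adds just one translate of the old
  span.\<close>

lemma span_insert_bit:
  fixes a :: "bit ^ 'n"
  shows "vec.span (insert a S) = vec.span S \<union> (+) a ` vec.span S"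
proof -
  have ex: "(\<exists>k. P k) \<longleftrightarrow> P 0 \<or> P 1" for P :: "bit \<Rightarrow> bool"
    by (metis bit_not_zero_iff)
  have "u \<in> (+) a ` vec.span S \<longleftrightarrow> u + a \<in> vec.span S" for u
    by (metis (no_types, lifting) add.commute bit_vec_add_self(2) image_iff)
  then show ?thesis
    by (auto simp: vec.span_insert ex)
qed

section \<open>Bases of three-dimensional codes\<close>

definition words :: "bit ^ 'n \<Rightarrow> bit ^ 'n \<Rightarrow> bit ^ 'n \<Rightarrow> (bit ^ 'n) set" where
  "words x y z = {x, y, x + y, z, x + z, y + z, x + y + z}"

text \<open>Listing the codewords replaces span and independence, so that a change of basis is a
  mere rearrangement of a finite set.\<close>

definition basis3 :: "(bit ^ 'n) set \<Rightarrow> bit ^ 'n \<Rightarrow> bit ^ 'n \<Rightarrow> bit ^ 'n \<Rightarrow> bool" where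
  "basis3 D x y z \<longleftrightarrow> 0 \<notin> words x y z \<and> D = insert 0 (words x y z)"

lemma span_three: "vec.span {z, y, x} = insert 0 (words x y z)"
  by (auto simp: words_def span_insert_bit image_Un ac_simps)

text \<open>Independence means that each vector avoids the span of the earlier ones, and over two
  elements this forbids exactly seven sums from vanishing.\<close>

lemma independent_three:
  "0 \<notin> words x y z \<longleftrightarrow> vec.independent {z, y, x} \<and> card {z, y, x} = 3"
proof -
  have *: "0 = a + b \<longleftrightarrow> a = b" for a b :: "bit ^ 'n"
    by (metis add.commute bit_vec_add_eq_iff add.right_neutral)
  show ?thesis
    by (auto simp: words_def vec.independent_insert span_insert_bit card_insert_if * ac_simps)
qed

lemma basis3_iff:
  "basis3 D x y z \<longleftrightarrow> D = vec.span {z, y, x} \<and> vec.independent {z, y, x} \<and> card {z, y, x} = 3"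
  by (auto simp: basis3_def span_three independent_three)

lemma basis3_exists:
  assumes "vec.subspace D" "vec.dim D = 3"
  obtains x y z where "basis3 D x y z"
proof -
  obtain B where B: "B \<subseteq> D" "vec.independent B" "D \<subseteq> vec.span B" "card B = 3"
    using vec.basis_exists[of D] assms(2) by metis
  then obtain z y x where "B = {z, y, x}"
    by (auto simp: card_3_iff)
  moreover have "D = vec.span B"
    using B assms(1) by (simp add: vec.span_minimal subset_antisym)
  ultimately show thesis
    using that B by (auto simp: basis3_iff)
qed

lemma basis3_dim:
  assumes "basis3 D x y z"
  shows "vec.subspace D" "vec.dim D = 3"
  using assms by (auto simp: basis3_iff vec.dim_eq_card_independent)

lemma basis3_swap12: "basis3 D x y z \<Longrightarrow> basis3 D y x z"
  by (auto simp: basis3_def words_def ac_simps)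

lemma basis3_swap23: "basis3 D x y z \<Longrightarrow> basis3 D x z y"
  by (auto simp: basis3_def words_def ac_simps)

lemma basis3_add: "basis3 D x y z \<Longrightarrow> basis3 D (x + y) y z"
  by (auto simp: basis3_def words_def ac_simps)

lemma basis3_add_third: "basis3 D x y z \<Longrightarrow> basis3 D x y (x + z)"
  by (metis add.commute basis3_add basis3_swap12 basis3_swap23)

section \<open>Inner products and the LCD condition\<close>

lemma scalar_product_add_left [simp]:
  fixes x y z :: "bit ^ 'n"
  shows "scalar_product (x + y) z = scalar_product x z + scalar_product y z"
  by (simp only: scalar_product_def vector_add_component sum.distrib distrib_right)

lemma scalar_product_add_right [simp]:
  fixes x y z :: "bit ^ 'n"
  shows "scalar_product x (y + z) = scalar_product x y + scalar_product x z"
  by (simp only: scalar_product_def vector_add_component sum.distrib distrib_left)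

lemma scalar_product_0 [simp]:
  fixes x :: "bit ^ 'n"
  shows "scalar_product 0 x = 0" "scalar_product x 0 = 0"
  by (simp_all add: scalar_product_def)

lemma scalar_product_commute:
  fixes x y :: "bit ^ 'n"
  shows "scalar_product x y = scalar_product y x"
  by (simp only: scalar_product_def mult.commute)

text \<open>A lift of the scalar product to the naturals, which allows weights to be compared modulo
  4.\<close>

definition overlap :: "bit ^ 'n \<Rightarrow> bit ^ 'n \<Rightarrow> nat" where
  "overlap x y = card {i. x $ i = 1 \<and> y $ i = 1}"

lemma scalar_product_overlap: "scalar_product x y = of_nat (overlap x y)"
proof -
  have "scalar_product x y = (\<Sum>i\<in>UNIV. of_bool (x $ i = 1 \<and> y $ i = 1))"
    unfolding scalar_product_def by (rule sum.cong) auto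
  then show ?thesis
    by (simp add: overlap_def)
qed

lemma of_nat_bit_eq_0_iff: "(of_nat k :: bit) = 0 \<longleftrightarrow> even k"
  by (induction k) auto

lemma of_nat_bit_eq_1_iff: "(of_nat k :: bit) = 1 \<longleftrightarrow> odd k"
  unfolding of_nat_bit_eq_0_iff[symmetric] by (rule bit_not_zero_iff[symmetric])

lemma scalar_product_self: "scalar_product x x = of_nat (hamming_weight x)"
  by (simp add: scalar_product_overlap overlap_def hamming_weight_def)

text \<open>A symmetric matrix with rows \<open>(a, b, c)\<close>, \<open>(b, d, e)\<close>,
  \<open>(c, e, f)\<close> has determinant 1 iff none of the seven nonempty sums of rows vanishes;
  the 64 cases are checked directly.\<close>

lemma gram_bits:
  fixes a b c d e f :: bit
  shows "a * d * f + a * e + d * c + f * b = 1 \<longleftrightarrow>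
    \<not> (a = 0 \<and> b = 0 \<and> c = 0) \<and> \<not> (b = 0 \<and> d = 0 \<and> e = 0) \<and> \<not> (a + b = 0 \<and> b + d = 0 \<and> c + e = 0) \<and>
    \<not> (c = 0 \<and> e = 0 \<and> f = 0) \<and> \<not> (a + c = 0 \<and> b + e = 0 \<and> c + f = 0) \<and>
    \<not> (b + c = 0 \<and> d + e = 0 \<and> e + f = 0) \<and> \<not> (a + b + c = 0 \<and> b + d + e = 0 \<and> c + e + f = 0)"
  by (cases a; cases b; cases c; cases d; cases e; cases f) simp_all

text \<open>The polynomial is the determinant of the Gram matrix; squares and the doubled term
  disappear over the two-element field.\<close>

lemma is_LCD_basis3:
  fixes x y z :: "bit ^ 'n"
  assumes "basis3 D x y z"
  defines "B \<equiv> scalar_product"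
  shows "is_LCD D \<longleftrightarrow>
    B x x * B y y * B z z + B x x * B y z + B y y * B x z + B z z * B x y = 1"
proof -
  have comm: "B y x = B x y" "B z x = B x z" "B z y = B y z"
    unfolding B_def by (rule scalar_product_commute)+
  have add: "B (u + v) w = B u w + B v w" "B w (u + v) = B w u + B w v" for u v w
    by (simp_all only: B_def scalar_product_add_left scalar_product_add_right)
  have B0: "B u 0 = 0" "B 0 u = 0" for u
    by (simp_all only: B_def scalar_product_0)
  have "(\<forall>c\<in>D. B u c = 0) \<longleftrightarrow> B u x = 0 \<and> B u y = 0 \<and> B u z = 0" for u
    using assms(1) by (auto simp: add B0 basis3_def words_def)
  moreover have "is_LCD D \<longleftrightarrow> (\<forall>u\<in>words x y z. \<not> (\<forall>c\<in>D. B u c = 0))"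
    using assms(1) unfolding is_LCD_def dual_code_def basis3_def B_def[symmetric]
    by (auto simp: B0)
  ultimately have "is_LCD D \<longleftrightarrow> (\<forall>u\<in>words x y z. \<not> (B u x = 0 \<and> B u y = 0 \<and> B u z = 0))"
    by simp
  also have "\<dots> \<longleftrightarrow> B x x * B y y * B z z + B x x * B y z + B y y * B x z + B z z * B x y = 1"
    unfolding gram_bits words_def by (simp only: ball_simps add comm simp_thms)
  finally show ?thesis .
qed

text \<open>An odd basis word \<open>z\<close> is found first; adding it to \<open>x\<close> or
  \<open>y\<close> where needed makes these even. The Gram determinant then reduces to the product
  of \<open>x\<close> and \<open>y\<close>, which must be 1.\<close>

lemma LCD_adapted_basis:
  assumes "basis3 D x0 y0 z0" "is_LCD D"
  obtains x y z where "basis3 D x y z" "even (hamming_weight x)" "even (hamming_weight y)"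
    "odd (hamming_weight z)" "odd (overlap x y)"
proof -
  let ?B = scalar_product
  obtain x1 y1 z where 1: "basis3 D x1 y1 z" "?B z z = 1"
  proof -
    \<comment> \<open>Every term of the determinant contains a diagonal entry, so the diagonal
      cannot be zero.\<close>
    have "?B x0 x0 = 1 \<or> ?B y0 y0 = 1 \<or> ?B z0 z0 = 1"
      using assms by (auto simp: is_LCD_basis3 simp flip: bit_not_zero_iff)
    then show thesis
      using that assms(1) by (meson basis3_swap12 basis3_swap23)
  qed
  obtain x where 2: "basis3 D x y1 z" "?B x x = 0"
  proof (cases "?B x1 x1 = 0")
    case False
    have "basis3 D (x1 + z) y1 z"
      using 1(1) by (meson basis3_add basis3_swap23)
    then show thesis
      using that 1(2) False by (simp add: scalar_product_commute)
  qed (use 1 that in blast)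
  obtain y where 3: "basis3 D x y z" "?B y y = 0"
  proof (cases "?B y1 y1 = 0")
    case False
    have "basis3 D x (y1 + z) z"
      using 2(1) by (meson basis3_add basis3_swap12 basis3_swap23)
    then show thesis
      using that 1(2) False by (simp add: scalar_product_commute)
  qed (use 2 that in blast)
  have "?B x y = 1"
    using assms(2) is_LCD_basis3[OF 3(1)] 1(2) 2(2) 3(2) by simp
  then show thesis
    using that[OF 3(1)] 1(2) 2(2) 3(2)
    unfolding scalar_product_self scalar_product_overlap[of x y] of_nat_bit_eq_0_iff of_nat_bit_eq_1_iff
    by blast
qed

section \<open>Column multiplicities of a generator matrix\<close>

definition col3 :: "bit ^ 'n \<Rightarrow> bit ^ 'n \<Rightarrow> bit ^ 'n \<Rightarrow> 'n \<Rightarrow> bool \<times> bool \<times> bool" where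
  "col3 x y z i = (x $ i = 1, y $ i = 1, z $ i = 1)"

definition col_count :: "bit ^ 'n \<Rightarrow> bit ^ 'n \<Rightarrow> bit ^ 'n \<Rightarrow> bool \<times> bool \<times> bool \<Rightarrow> nat" where
  "col_count x y z v = card {i. col3 x y z i = v}"

lemma card_Collect_fibres:
  fixes f :: "'n::finite \<Rightarrow> 'v::finite"
  shows "card {i. P (f i)} = (\<Sum>v\<in>UNIV. if P v then card {i. f i = v} else 0)"
proof -
  have "{i. P (f i)} = (\<Union>v\<in>{v. P v}. {i. f i = v})"
    by auto
  then have "card {i. P (f i)} = (\<Sum>v\<in>{v. P v}. card {i. f i = v})"
    by (simp only:) (rule card_UN_disjoint; auto)
  then show ?thesis
    by (simp add: sum.If_cases)
qed

lemma UNIV_bool3: "(UNIV :: (bool \<times> bool \<times> bool) set) =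
  {(False, False, False), (True, False, False), (False, True, False), (True, True, False),
   (False, False, True), (True, False, True), (False, True, True), (True, True, True)}"
  by auto

lemma bit_add_is_1: "a + b = (1::bit) \<longleftrightarrow> (a = 1) \<noteq> (b = 1)"
  by (cases a; cases b) auto

text \<open>A column adds to the weight of a codeword iff the corresponding sum of its entries is 1.
  The later arguments use only these linear equations.\<close>

lemma weights_col_count:
  fixes x y z :: "bit ^ 'n"
  defines "m \<equiv> \<lambda>a b c. col_count x y z (a, b, c)"
  shows "hamming_weight x = m True False False + m True True False + m True False True + m True True True"
    and "hamming_weight y = m False True False + m True True False + m False True True + m True True True"
    and "hamming_weight z = m False False True + m True False True + m False True True + m True True True"
    and "hamming_weight (x + y) = m True False False + m False True False + m True False True + m False True True"
    and "hamming_weight (x + z) = m True False False + m True True False + m False False True + m False True True"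
    and "hamming_weight (y + z) = m False True False + m True True False + m False False True + m True False True"
    and "hamming_weight (x + y + z) = m True False False + m False True False + m False False True + m True True True"
    and "overlap x y = m True True False + m True True True"
    and "CARD('n) = m False False False + m True False False + m False True False + m True True False
      + m False False True + m True False True + m False True True + m True True True"
proof -
  have c: "card {i. Q i} = (\<Sum>v\<in>UNIV. if P v then col_count x y z v else 0)"
    if "\<And>i. Q i \<longleftrightarrow> P (col3 x y z i)" for P Q
    using card_Collect_fibres[of P "col3 x y z"] that unfolding col_count_def by simp
  note sums = UNIV_bool3 m_def hamming_weight_def overlap_def col3_def bit_add_is_1
  show "hamming_weight x = m True False False + m True True False + m True False True + m True True True"
    using c[of "\<lambda>i. x $ i = 1" "\<lambda>(a, b, c). a"] by (simp add: sums)
  show "hamming_weight y = m False True False + m True True False + m False True True + m True True True"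
    using c[of "\<lambda>i. y $ i = 1" "\<lambda>(a, b, c). b"] by (simp add: sums)
  show "hamming_weight z = m False False True + m True False True + m False True True + m True True True"
    using c[of "\<lambda>i. z $ i = 1" "\<lambda>(a, b, c). c"] by (simp add: sums)
  show "hamming_weight (x + y) = m True False False + m False True False + m True False True + m False True True"
    using c[of "\<lambda>i. (x + y) $ i = 1" "\<lambda>(a, b, c). a \<noteq> b"] by (simp add: sums)
  show "hamming_weight (x + z) = m True False False + m True True False + m False False True + m False True True"
    using c[of "\<lambda>i. (x + z) $ i = 1" "\<lambda>(a, b, c). a \<noteq> c"] by (simp add: sums)
  show "hamming_weight (y + z) = m False True False + m True True False + m False False True + m True False True"
    using c[of "\<lambda>i. (y + z) $ i = 1" "\<lambda>(a, b, c). b \<noteq> c"] by (simp add: sums)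
  show "hamming_weight (x + y + z) = m True False False + m False True False + m False False True + m True True True"
    using c[of "\<lambda>i. (x + y + z) $ i = 1" "\<lambda>(a, b, c). (a \<noteq> b) \<noteq> c"] by (simp add: sums)
  show "overlap x y = m True True False + m True True True"
    using c[of "\<lambda>i. x $ i = 1 \<and> y $ i = 1" "\<lambda>(a, b, c). a \<and> b"] by (simp add: sums)
  show "CARD('n) = m False False False + m True False False + m False True False + m True True False
      + m False False True + m True False True + m False True True + m True True True"
    using c[of "\<lambda>i. True" "\<lambda>(a, b, c). True"] by (simp add: sums)
qed

section \<open>The extremal weight distribution\<close>

text \<open>A normal form: \<open>x\<close> and \<open>z\<close> are the words that exceed by 2 the
  least weights \<open>4 * q\<close> and \<open>4 * q + 2 * t - 1\<close> of their parities.\<close>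

definition extremal :: "nat \<Rightarrow> nat \<Rightarrow> bit ^ 'n \<Rightarrow> bit ^ 'n \<Rightarrow> bit ^ 'n \<Rightarrow> bool" where
  "extremal q t x y z \<longleftrightarrow>
    hamming_weight x = 4 * q + 2 \<and> hamming_weight y = 4 * q \<and> hamming_weight (x + y) = 4 * q \<and>
    hamming_weight z = 4 * q + 2 * t + 1 \<and> hamming_weight (x + z) = 4 * q + 2 * t - 1 \<and>
    hamming_weight (y + z) = 4 * q + 2 * t - 1 \<and> hamming_weight (x + y + z) = 4 * q + 2 * t - 1"

text \<open>The solution of the weight equations for \<open>extremal\<close>. For
  \<open>q \<ge> 1\<close> no subtraction truncates, and the values sum to
  \<open>7 * q + 2 * t\<close>.\<close>

fun extremal_count :: "nat \<Rightarrow> nat \<Rightarrow> bool \<times> bool \<times> bool \<Rightarrow> nat" where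
  "extremal_count q t (False, False, False) = 0"
| "extremal_count q t (True, False, False) = q"
| "extremal_count q t (False, True, False) = q - 1"
| "extremal_count q t (True, True, False) = q"
| "extremal_count q t (False, False, True) = q + 2 * t - 1"
| "extremal_count q t (True, False, True) = q + 1"
| "extremal_count q t (False, True, True) = q"
| "extremal_count q t (True, True, True) = q + 1"

text \<open>The seven weights determine the multiplicities of the seven nonzero columns, and the
  length then fixes that of the zero column.\<close>

lemma extremal_iff_count:
  fixes x y z :: "bit ^ 'n"
  assumes "CARD('n) = 7 * q + 2 * t" "q \<ge> 1"
  shows "extremal q t x y z \<longleftrightarrow> (\<forall>v. col_count x y z v = extremal_count q t v)"
proof -
  obtain q' where q: "q = Suc q'"
    using assms(2) by (cases q) auto
  note eqs = weights_col_count[where x = x and y = y and z = z]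
  show ?thesis
  proof
    assume "extremal q t x y z"
    then have ws: "hamming_weight x = 4 * q' + 6" "hamming_weight y = 4 * q' + 4"
      "hamming_weight (x + y) = 4 * q' + 4" "hamming_weight z = 4 * q' + 2 * t + 5"
      "hamming_weight (x + z) = 4 * q' + 2 * t + 3" "hamming_weight (y + z) = 4 * q' + 2 * t + 3"
      "hamming_weight (x + y + z) = 4 * q' + 2 * t + 3"
      by (simp_all add: extremal_def q)
    let ?m = "\<lambda>a b c. col_count x y z (a, b, c)"
    \<comment> \<open>This equation and the next three are overlaps, each half of the sum of two
      weights minus the weight of the sum: \<open>x\<close> with \<open>y\<close>, \<open>x\<close>
      with \<open>z\<close>, \<open>y\<close> with \<open>z\<close>, and \<open>x + y\<close> with
      \<open>z\<close>. The last makes the system solvable.\<close>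
    have "?m True True False + ?m True True True = 2 * q' + 3"
      using eqs(1,2,4)[unfolded ws] by linarith
    moreover have "?m True False True + ?m True True True = 2 * q' + 4"
      using eqs(1,3,5)[unfolded ws] by linarith
    moreover have "?m False True True + ?m True True True = 2 * q' + 3"
      using eqs(2,3,6)[unfolded ws] by linarith
    moreover have "?m True False True + ?m False True True = 2 * q' + 3"
      using eqs(4,3,7)[unfolded ws] by linarith
    ultimately have m: "?m True True True = q' + 2" "?m True True False = q' + 1"
      "?m True False True = q' + 2" "?m False True True = q' + 1"
      by linarith+
    moreover have m': "?m True False False = q' + 1" "?m False True False = q'"
      "?m False False True = q' + 2 * t"
      using eqs(1-3)[unfolded ws m] by linarith+
    moreover have "?m False False False = 0"
      using eqs(9)[unfolded m m' assms(1)] q by simp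
    ultimately have "\<forall>v\<in>UNIV. col_count x y z v = extremal_count q t v"
      unfolding UNIV_bool3 q by simp
    then show "\<forall>v. col_count x y z v = extremal_count q t v"
      by simp
  next
    assume "\<forall>v. col_count x y z v = extremal_count q t v"
    then show "extremal q t x y z"
      using eqs(1-7) by (simp add: extremal_def q)
  qed
qed

lemma extremal_exists:
  assumes "CARD('n::finite) = 7 * q + 2 * t" "q \<ge> 1"
  obtains x y z :: "bit ^ 'n" where "extremal q t x y z"
proof -
  \<comment> \<open>One block of indices per column, of the prescribed size; a bijection
    \<open>h\<close> from the coordinates assigns each its column.\<close>
  let ?S = "SIGMA v:UNIV. {..<extremal_count q t v}"
  have "card ?S = 7 * q + 2 * t"
    using assms(2) by (simp add: UNIV_bool3)
  then obtain h :: "'n \<Rightarrow> _" where h: "bij_betw h UNIV ?S"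
    using assms(1) by (metis (no_types, lifting) finite_same_card_bij finite_class.finite_UNIV finite_SigmaI finite_lessThan)
  define x y z :: "bit ^ 'n" where "x = (\<chi> i. of_bool (fst (fst (h i))))"
    and "y = (\<chi> i. of_bool (fst (snd (fst (h i)))))" and "z = (\<chi> i. of_bool (snd (snd (fst (h i)))))"
  have col: "col3 x y z i = fst (h i)" for i
    by (simp add: col3_def x_def y_def z_def)
  have "col_count x y z v = extremal_count q t v" for v
  proof -
    have "h ` {i. fst (h i) = v} = {v} \<times> {..<extremal_count q t v}"
      using bij_betw_imp_surj_on[OF h] by (auto simp: image_iff set_eq_iff) (metis fst_conv)+
    moreover have "inj_on h {i. fst (h i) = v}"
      using h by (meson bij_betw_def inj_on_subset subset_UNIV)
    ultimately have "card {i. fst (h i) = v} = extremal_count q t v"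
      using card_image by fastforce
    then show ?thesis
      by (simp add: col_count_def col)
  qed
  then show thesis
    using that extremal_iff_count[OF assms] by blast
qed

section \<open>Equivalence from equal multiplicities\<close>

text \<open>Equal multisets of columns differ by a permutation of coordinates. It acts additively,
  so it carries all words along with the basis.\<close>

lemma code_equiv_if_col_count_eq:
  fixes x y z x' y' z' :: "bit ^ 'n"
  assumes C: "basis3 C x y z" and D: "basis3 D x' y' z'"
    and eq: "\<And>v. col_count x y z v = col_count x' y' z' v"
  shows "code_equiv C D"
proof -
  have "image_mset (col3 x' y' z') (mset_set UNIV) = image_mset (col3 x y z) (mset_set UNIV)"
    using eq by (intro multiset_eqI) (simp add: count_image_mset' col_count_def eq_commute)
  then obtain p where p: "p permutes UNIV" "\<And>i. col3 x' y' z' i = col3 x y z (p i)"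
    using image_mset_eq_implies_permutes[of UNIV "col3 x' y' z'" "col3 x y z"] by auto
  let ?f = "\<lambda>u::bit ^ 'n. \<chi> i. u $ p i"
  have "x' = ?f x" "y' = ?f y" "z' = ?f z"
    using p(2) unfolding col3_def vec_eq_iff by (simp_all, metis bit_not_zero_iff)+
  moreover have "?f (u + v) = ?f u + ?f v" "?f 0 = 0" for u v
    by (simp_all add: vec_eq_iff)
  ultimately have "?f ` C = insert 0 (words x' y' z')"
    using C by (simp only: basis3_def words_def image_insert image_empty)
  then have "D = ?f ` C"
    using D by (simp add: basis3_def)
  then show ?thesis
    using p(1) permutes_bij unfolding code_equiv_def by blast
qed

section \<open>Weights of an LCD code with the given parameters\<close>

text \<open>Each even weight is at least \<open>4 * q\<close> and each odd one at least \<open>4 * q + 2 * t - 1\<close>. The odd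
  overlap makes \<open>a + b + c \<equiv> 2 (mod 4)\<close>, so the given total leaves an excess of exactly 2
  for either group.\<close>

lemma extremal_weights:
  fixes a b c o' p r s u q t k :: nat
  assumes "a + b + c + p + r + s + u + 4 * k = 4 * (7 * q + 2 * t)" "q \<ge> 1" "t \<le> 1"
    and "a + b = c + 2 * o'" "odd o'"
    and "even a" "even b" "even c" "odd p" "odd r" "odd s" "odd u"
    and ge: "a \<ge> 4 * q + t - 1" "b \<ge> 4 * q + t - 1" "c \<ge> 4 * q + t - 1" "p \<ge> 4 * q + t - 1"
      "r \<ge> 4 * q + t - 1" "s \<ge> 4 * q + t - 1" "u \<ge> 4 * q + t - 1"
  shows "(a, b, c) \<in> {(4*q+2, 4*q, 4*q), (4*q, 4*q+2, 4*q), (4*q, 4*q, 4*q+2)}"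
    and "let l = 4*q + 2*t - 1; h = 4*q + 2*t + 1 in
      (p, r, s, u) \<in> {(h, l, l, l), (l, h, l, l), (l, l, h, l), (l, l, l, h)}"
proof -
  have t: "t = 0 \<or> t = 1" using assms(3) by auto
  \<comment> \<open>For \<open>t = 0\<close> the bound is \<open>4 * q - 1\<close> and parity raises
    the even weights; for \<open>t = 1\<close> it is \<open>4 * q\<close> and parity raises the odd
    ones.\<close>
  have "w \<ge> 4 * q" if "even w" "w \<ge> 4 * q + t - 1" for w
    using t that assms(2) by (elim disjE; simp) presburger
  note low_even = this[OF assms(6) ge(1)] this[OF assms(7) ge(2)] this[OF assms(8) ge(3)]
  have "w \<ge> 4 * q + 2 * t - 1" if "odd w" "w \<ge> 4 * q + t - 1" for w
    using t that assms(2) by (elim disjE; simp) presburger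
  note low_odd = this[OF assms(9) ge(4)] this[OF assms(10) ge(5)] this[OF assms(11) ge(6)] this[OF assms(12) ge(7)]
  have ex: "\<exists>w'. w = 4*q + 2*w'" if "even w" "w \<ge> 4*q" for w
    using that by presburger
  obtain a' b' c' where abc: "a = 4*q + 2*a'" "b = 4*q + 2*b'" "c = 4*q + 2*c'"
    using ex assms(6-8) low_even by metis
  define l where "l = 4*q + 2*t - 1"
  have l: "l + 1 = 4*q + 2*t"
    using assms(2) by (simp add: l_def)
  have "\<exists>w'. w = l + 2*w'" if "odd w" "w \<ge> l" for w
    using that l by presburger
  then obtain p' r' s' u' where prsu: "p = l + 2*p'" "r = l + 2*r'" "s = l + 2 * s'" "u = l + 2*u'"
    using assms(9-12) low_odd unfolding l_def[symmetric] by metis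
  \<comment> \<open>The least weights add up to \<open>28 * q + 8 * t - 4\<close>, so an excess of 4
    is left, here halved.\<close>
  have sum: "a' + b' + c' + p' + r' + s' + u' + 2 * k = 2"
    using assms(1) l unfolding abc prsu by presburger
  have "odd (a' + b' + c')"
    using assms(4,5) unfolding abc by presburger
  \<comment> \<open>An odd number at most 2 is 1; the remaining 1 leaves no room for
    \<open>2 * k\<close>.\<close>
  then have "a' + b' + c' = 1" "p' + r' + s' + u' = 1"
    using sum by presburger+
  moreover have "4*q + 2*t + 1 = l + 2"
    using l by simp
  ultimately show "(a, b, c) \<in> {(4*q+2, 4*q, 4*q), (4*q, 4*q+2, 4*q), (4*q, 4*q, 4*q+2)}"
    and "let l = 4*q + 2*t - 1; h = 4*q + 2*t + 1 in
      (p, r, s, u) \<in> {(h, l, l, l), (l, h, l, l), (l, l, h, l), (l, l, l, h)}"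
    unfolding abc prsu Let_def l_def[symmetric] by (auto simp: add_is_1)
qed

lemma hamming_weight_add: "hamming_weight (x + y) + 2 * overlap x y = hamming_weight x + hamming_weight y"
  using weights_col_count[where x = x and y = y and z = 0] by linarith

text \<open>The weights are known only up to the position of the two heavier words; a change of
  basis moves these to \<open>x\<close> and \<open>z\<close>.\<close>

lemma LCD_extremal_basis:
  fixes D :: "(bit ^ 'n) set"
  assumes D: "is_code D (7 * q + 2 * t) 3 (4 * q + t - 1)" "is_LCD D" and qt: "q \<ge> 1" "t \<le> 1"
  obtains x y z where "basis3 D x y z" "extremal q t x y z"
proof -
  have card: "CARD('n) = 7 * q + 2 * t" and sub: "vec.subspace D" "vec.dim D = 3"
    and min: "min_weight D = 4 * q + t - 1"
    using D(1) by (auto simp: is_code_def)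
  obtain x y z where B: "basis3 D x y z" and par: "even (hamming_weight x)" "even (hamming_weight y)"
      "odd (hamming_weight z)" and ov: "odd (overlap x y)"
    using LCD_adapted_basis basis3_exists[OF sub] D(2) by metis
  have "finite D"
    using B by (simp add: basis3_def words_def)
  then have ge: "hamming_weight u \<ge> 4 * q + t - 1" if "u \<in> words x y z" for u
    using B that unfolding min[symmetric] min_weight_def by (intro Min_le) (auto simp: basis3_def)
  have par': "even (hamming_weight (x + y))" "odd (hamming_weight (x + z))"
    "odd (hamming_weight (y + z))" "odd (hamming_weight (x + y + z))"
    using par hamming_weight_add[of x y] hamming_weight_add[of x z] hamming_weight_add[of y z]
      hamming_weight_add[of "x + y" z] by presburger+
  have total: "hamming_weight x + hamming_weight y + hamming_weight (x + y) + hamming_weight z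
      + hamming_weight (x + z) + hamming_weight (y + z) + hamming_weight (x + y + z)
      + 4 * col_count x y z (False, False, False) = 4 * (7 * q + 2 * t)"
    unfolding card[symmetric] weights_col_count[where x = x and y = y and z = z] by simp
  note W = extremal_weights[OF total qt hamming_weight_add[symmetric] ov par(1,2) par'(1) par(3) par'(2-4)]
  have evens: "(hamming_weight x, hamming_weight y, hamming_weight (x + y))
      \<in> {(4*q+2, 4*q, 4*q), (4*q, 4*q+2, 4*q), (4*q, 4*q, 4*q+2)}"
    by (rule W(1)) (rule ge, simp add: words_def)+
  have odds: "let l = 4*q + 2*t - 1; h = 4*q + 2*t + 1 in
    (hamming_weight z, hamming_weight (x + z), hamming_weight (y + z), hamming_weight (x + y + z))
      \<in> {(h, l, l, l), (l, h, l, l), (l, l, h, l), (l, l, l, h)}"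
    by (rule W(2)) (rule ge, simp add: words_def)+
  note Z = B basis3_add_third[OF B] basis3_swap12[OF basis3_add_third[OF basis3_swap12[OF B]]]
  have base: "basis3 D x y z'" if "z' \<in> {z, x + z, y + z, x + (y + z)}" for z'
    using that Z basis3_add_third[OF Z(3)] by auto
  \<comment> \<open>The first entries run through the nonzero even words and \<open>z'\<close>
    through the odd words; the two choices are independent.\<close>
  have bases: "basis3 D x' y' z'"
    if "(x', y') \<in> {(x, y), (y, x), (x + y, y)}" "z' \<in> {z, x + z, y + z, x + (y + z)}" for x' y' z'
    using that(1) base[OF that(2)] basis3_swap12[OF base[OF that(2)]] basis3_add[OF base[OF that(2)]]
    by auto
  have "\<exists>(x', y') \<in> {(x, y), (y, x), (x + y, y)}. \<exists>z' \<in> {z, x + z, y + z, x + (y + z)}. extremal q t x' y' z'"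
    using evens odds unfolding Let_def by (auto simp: extremal_def ac_simps)
  then show thesis
    using that bases by blast
qed

section \<open>Existence and uniqueness\<close>

lemma extremal_code:
  fixes x y z :: "bit ^ 'n"
  assumes card: "CARD('n) = 7 * q + 2 * t" and qt: "q \<ge> 1" "t \<le> 1" and E: "extremal q t x y z"
  defines "C \<equiv> insert 0 (words x y z)"
  shows "basis3 C x y z" "is_code C (7 * q + 2 * t) 3 (4 * q + t - 1)" "is_LCD C"
proof -
  have pos: "hamming_weight u > 0" if "u \<in> words x y z" for u
    using that E qt by (auto simp: words_def extremal_def)
  then show B: "basis3 C x y z"
    by (force simp: basis3_def C_def hamming_weight_def)
  have "hamming_weight ` (C - {0}) = hamming_weight ` words x y z"
    using B by (auto simp: basis3_def)
  also have "\<dots> = {4 * q + 2, 4 * q, 4 * q + 2 * t + 1, 4 * q + 2 * t - 1}"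
    using E by (auto simp: words_def extremal_def)
  \<comment> \<open>For \<open>t = 0\<close> the minimum is the odd weight \<open>4 * q - 1\<close>,
    for \<open>t = 1\<close> the even weight \<open>4 * q\<close>.\<close>
  finally have "min_weight C = 4 * q + t - 1"
    using qt by (cases "t = 0") (auto simp: min_weight_def)
  then show "is_code C (7 * q + 2 * t) 3 (4 * q + t - 1)"
    using basis3_dim[OF B] card by (simp add: is_code_def)
  have "overlap x y = 2 * q + 1"
    using hamming_weight_add[of x y] E by (simp add: extremal_def)
  then have "scalar_product x y = 1"
    unfolding scalar_product_overlap of_nat_bit_eq_1_iff by simp
  moreover have "scalar_product x x = 0" "scalar_product y y = 0" "scalar_product z z = 1"
    using E unfolding scalar_product_self of_nat_bit_eq_0_iff of_nat_bit_eq_1_iff extremal_def by simp_all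
  ultimately show "is_LCD C"
    unfolding is_LCD_basis3[OF B] by simp
qed

theorem theorem5p12:
  fixes n :: nat
  assumes "CARD('n::finite) = n"
    and "n \<ge> 7"
    and "n mod 7 = 0 \<or> n mod 7 = 2"
  shows "\<exists>C :: (bit ^ 'n) set.
           (is_code C n 3 (4 * n div 7 - 1) \<and> is_LCD C) \<and>
           (\<forall>D :: (bit ^ 'n) set.
              is_code D n 3 (4 * n div 7 - 1) \<and> is_LCD D \<longrightarrow> code_equiv C D)"
proof -
  define q where "q = n div 7"
  define t where "t = (n mod 7) div 2"
  have n: "n = 7 * q + 2 * t"
    using assms(3) unfolding q_def t_def by presburger
  have qt: "q \<ge> 1" "t \<le> 1"
    using assms(2,3) by (auto simp: q_def t_def)
  \<comment> \<open>Division with remainder \<open>t\<close>, since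
    \<open>t \<le> 1 < 7\<close>.\<close>
  have "4 * n = t + (4 * q + t) * 7"
    using n by simp
  then have d: "4 * n div 7 - 1 = 4 * q + t - 1"
    using qt(2) by simp
  have card: "CARD('n) = 7 * q + 2 * t"
    using assms(1) n by simp
  obtain x y z :: "bit ^ 'n" where E: "extremal q t x y z"
    using extremal_exists[OF card qt(1)] .
  let ?C = "insert 0 (words x y z)"
  note C = extremal_code[OF card qt E]
  have "code_equiv ?C D" if code: "is_code D n 3 (4 * n div 7 - 1)" "is_LCD D" for D :: "(bit ^ 'n) set"
  proof -
    obtain x' y' z' where D: "basis3 D x' y' z'" "extremal q t x' y' z'"
      using LCD_extremal_basis[OF code[unfolded d, unfolded n] qt] .
    have "col_count x y z v = col_count x' y' z' v" for v
      using E D(2) extremal_iff_count[OF card qt(1)] by metis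
    then show ?thesis
      using code_equiv_if_col_count_eq[OF C(1) D(1)] by blast
  qed
  then show ?thesis
    using C(2,3) unfolding d unfolding n by blast
qed

end
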